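(* There exists an algebra $\mathbf{D}=(D;\sqcap,\sqcup,\neg,\lrcorner,\top,\bot)$ of type $(2,2,1,1,0,0)$ that satisfies the identities (1a)–(4a), (1b)–(4b), (6a), (6b) and (7) listed below, but satisfies neither (5a) nor (5b).
   Context: Write $x\vee y:=\neg(\neg x\sqcap\neg y)$ and $x\wedge y:=\lrcorner(\lrcorner x\sqcup\lrcorner y)$. The identities (for all $x,y,z\in D$) are: (1a) $x\sqcap y=y\sqcap x$, (1b) $x\sqcup y=y\sqcup x$; (2a) $\neg(x\sqcap x)=\neg x$, (2b) $\lrcorner(x\sqcup x)=\lrcorner x$; (3a) $x\sqcap(x\sqcup y)=x\sqcap x$, (3b) $x\sqcup(x\sqcap y)=x\sqcup x$; (4a) $x\sqcap(y\vee z)=(x\sqcap y)\vee(x\sqcap z)$, (4b) $x\sqcup(y\wedge z)=(x\sqcup y)\wedge(x\sqcup z)$; (5a) $\neg\neg(x\sqcap y)=x\sqcap y$, (5b) $\lrcorner\lrcorner(x\sqcup y)=x\sqcup y$; (6a) $x\sqcap\neg x=\bot$, (6b) $x\sqcup\lrcorner x=\top$; (7) $(x\sqcap x)\sqcup(x\sqcap x)=(x\sqcup x)\sqcap(x\sqcup x)$. *)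

theory Defs
  imports Main
begin

text \<open>
  Algebras of type \<open>(2,2,1,1,0,0)\<close> on an explicit carrier. The record only fixes the
  signature; that the carrier is closed under the operations is \<open>is_algebra\<close> below.
  The fields \<open>neg\<close> and \<open>opp\<close> are \<open>\<not>\<close> and the reversed negation (written \<open>\<lrcorner>\<close> in the
  literature on double Boolean algebras). Existence of an algebra is stated over carriers
  \<open>\<subseteq> \<nat>\<close>: HOL cannot quantify existentially over types, and as the signature is countable this
  is no restriction (downward Loewenheim-Skolem).
\<close>

record 'a dalg =
  carrier :: "'a set"
  meet :: "'a \<Rightarrow> 'a \<Rightarrow> 'a"  (infixl \<open>\<sqinter>\<index>\<close> 70)
  join :: "'a \<Rightarrow> 'a \<Rightarrow> 'a"  (infixl \<open>\<squnion>\<index>\<close> 65)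
  neg  :: "'a \<Rightarrow> 'a"
  opp  :: "'a \<Rightarrow> 'a"
  top_el :: "'a"  (\<open>\<top>\<index>\<close>)
  bot_el :: "'a"  (\<open>\<bottom>\<index>\<close>)

definition is_algebra :: "('a, 'b) dalg_scheme \<Rightarrow> bool" where
  "is_algebra A \<longleftrightarrow>
     (\<forall>x\<in>carrier A. \<forall>y\<in>carrier A. x \<sqinter>\<^bsub>A\<^esub> y \<in> carrier A \<and> x \<squnion>\<^bsub>A\<^esub> y \<in> carrier A) \<and>
     (\<forall>x\<in>carrier A. neg A x \<in> carrier A \<and> opp A x \<in> carrier A) \<and>
     \<top>\<^bsub>A\<^esub> \<in> carrier A \<and> \<bottom>\<^bsub>A\<^esub> \<in> carrier A"

definition vee :: "('a, 'b) dalg_scheme \<Rightarrow> 'a \<Rightarrow> 'a \<Rightarrow> 'a"  (infixl \<open>\<or>\<index>\<close> 65) where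
  "x \<or>\<^bsub>A\<^esub> y = neg A (neg A x \<sqinter>\<^bsub>A\<^esub> neg A y)"

definition wedge :: "('a, 'b) dalg_scheme \<Rightarrow> 'a \<Rightarrow> 'a \<Rightarrow> 'a"  (infixl \<open>\<and>\<index>\<close> 70) where
  "x \<and>\<^bsub>A\<^esub> y = opp A (opp A x \<squnion>\<^bsub>A\<^esub> opp A y)"

definition id_1a :: "('a, 'b) dalg_scheme \<Rightarrow> bool" where
  "id_1a A \<longleftrightarrow> (\<forall>x\<in>carrier A. \<forall>y\<in>carrier A. x \<sqinter>\<^bsub>A\<^esub> y = y \<sqinter>\<^bsub>A\<^esub> x)"

definition id_1b :: "('a, 'b) dalg_scheme \<Rightarrow> bool" where
  "id_1b A \<longleftrightarrow> (\<forall>x\<in>carrier A. \<forall>y\<in>carrier A. x \<squnion>\<^bsub>A\<^esub> y = y \<squnion>\<^bsub>A\<^esub> x)"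

definition id_2a :: "('a, 'b) dalg_scheme \<Rightarrow> bool" where
  "id_2a A \<longleftrightarrow> (\<forall>x\<in>carrier A. neg A (x \<sqinter>\<^bsub>A\<^esub> x) = neg A x)"

definition id_2b :: "('a, 'b) dalg_scheme \<Rightarrow> bool" where
  "id_2b A \<longleftrightarrow> (\<forall>x\<in>carrier A. opp A (x \<squnion>\<^bsub>A\<^esub> x) = opp A x)"

definition id_3a :: "('a, 'b) dalg_scheme \<Rightarrow> bool" where
  "id_3a A \<longleftrightarrow> (\<forall>x\<in>carrier A. \<forall>y\<in>carrier A. x \<sqinter>\<^bsub>A\<^esub> (x \<squnion>\<^bsub>A\<^esub> y) = x \<sqinter>\<^bsub>A\<^esub> x)"

definition id_3b :: "('a, 'b) dalg_scheme \<Rightarrow> bool" where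
  "id_3b A \<longleftrightarrow> (\<forall>x\<in>carrier A. \<forall>y\<in>carrier A. x \<squnion>\<^bsub>A\<^esub> (x \<sqinter>\<^bsub>A\<^esub> y) = x \<squnion>\<^bsub>A\<^esub> x)"

definition id_4a :: "('a, 'b) dalg_scheme \<Rightarrow> bool" where
  "id_4a A \<longleftrightarrow> (\<forall>x\<in>carrier A. \<forall>y\<in>carrier A. \<forall>z\<in>carrier A.
     x \<sqinter>\<^bsub>A\<^esub> (y \<or>\<^bsub>A\<^esub> z) = (x \<sqinter>\<^bsub>A\<^esub> y) \<or>\<^bsub>A\<^esub> (x \<sqinter>\<^bsub>A\<^esub> z))"

definition id_4b :: "('a, 'b) dalg_scheme \<Rightarrow> bool" where
  "id_4b A \<longleftrightarrow> (\<forall>x\<in>carrier A. \<forall>y\<in>carrier A. \<forall>z\<in>carrier A.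
     x \<squnion>\<^bsub>A\<^esub> (y \<and>\<^bsub>A\<^esub> z) = (x \<squnion>\<^bsub>A\<^esub> y) \<and>\<^bsub>A\<^esub> (x \<squnion>\<^bsub>A\<^esub> z))"

definition id_5a :: "('a, 'b) dalg_scheme \<Rightarrow> bool" where
  "id_5a A \<longleftrightarrow> (\<forall>x\<in>carrier A. \<forall>y\<in>carrier A. neg A (neg A (x \<sqinter>\<^bsub>A\<^esub> y)) = x \<sqinter>\<^bsub>A\<^esub> y)"

definition id_5b :: "('a, 'b) dalg_scheme \<Rightarrow> bool" where
  "id_5b A \<longleftrightarrow> (\<forall>x\<in>carrier A. \<forall>y\<in>carrier A. opp A (opp A (x \<squnion>\<^bsub>A\<^esub> y)) = x \<squnion>\<^bsub>A\<^esub> y)"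

definition id_6a :: "('a, 'b) dalg_scheme \<Rightarrow> bool" where
  "id_6a A \<longleftrightarrow> (\<forall>x\<in>carrier A. x \<sqinter>\<^bsub>A\<^esub> neg A x = \<bottom>\<^bsub>A\<^esub>)"

definition id_6b :: "('a, 'b) dalg_scheme \<Rightarrow> bool" where
  "id_6b A \<longleftrightarrow> (\<forall>x\<in>carrier A. x \<squnion>\<^bsub>A\<^esub> opp A x = \<top>\<^bsub>A\<^esub>)"

definition id_7 :: "('a, 'b) dalg_scheme \<Rightarrow> bool" where
  "id_7 A \<longleftrightarrow> (\<forall>x\<in>carrier A.
     (x \<sqinter>\<^bsub>A\<^esub> x) \<squnion>\<^bsub>A\<^esub> (x \<sqinter>\<^bsub>A\<^esub> x) = (x \<squnion>\<^bsub>A\<^esub> x) \<sqinter>\<^bsub>A\<^esub> (x \<squnion>\<^bsub>A\<^esub> x))"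

end

theory Submission
  imports Defs
begin

text \<open>Take the two-element lattice with \<open>neg\<close> constantly the bottom and
  \<open>opp\<close> constantly the top. Commutativity, absorption and \<open>id_7\<close> are
  lattice laws; constancy gives \<open>id_2a\<close> and \<open>id_2b\<close>; \<open>id_6a\<close>
  and \<open>id_6b\<close> hold since 0 is least and 1 greatest.\<close>

definition const_neg_algebra :: "nat dalg" where
  "const_neg_algebra = \<lparr>carrier = {0, 1}, meet = min, join = max,
     neg = (\<lambda>_. 0), opp = (\<lambda>_. 1), top_el = 1, bot_el = 0\<rparr>"

theorem theorem3p14:
  shows "\<exists>A :: nat dalg. is_algebra A \<and>
    id_1a A \<and> id_2a A \<and> id_3a A \<and> id_4a A \<and>
    id_1b A \<and> id_2b A \<and> id_3b A \<and> id_4b A \<and>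
    id_6a A \<and> id_6b A \<and> id_7 A \<and>
    \<not> id_5a A \<and> \<not> id_5b A"
proof (intro exI[of _ const_neg_algebra] conjI)
  \<comment> \<open>Both negations are constant, so \<open>\<not>\<not>\<close> sends 1 to 0 and \<open>\<lrcorner>\<lrcorner>\<close> sends 0 to 1.\<close>
  show "\<not> id_5a const_neg_algebra" "\<not> id_5b const_neg_algebra"
    by (auto simp: const_neg_algebra_def id_5a_def id_5b_def)
\<comment> \<open>Distributivity degenerates: \<open>vee\<close> is constantly 0 and
  \<open>wedge\<close> constantly 1, so both sides of \<open>id_4a\<close> are 0 and both sides of
  \<open>id_4b\<close> are 1.\<close>
qed (auto simp: const_neg_algebra_def is_algebra_def vee_def wedge_def
    id_1a_def id_2a_def id_3a_def id_4a_def id_1b_def id_2b_def id_3b_def id_4b_def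
    id_6a_def id_6b_def id_7_def)

end
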